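(* Let $0 < \alpha, p < 1 < c < 2$. Then for all sufficiently large $N$ there exist $N$-dimensional cooperative Boolean networks that are $p$-$c$-chaotic and exhibit $p$-$\alpha$-decoherence.
   Context: Write $[N]=\{1,\dots,N\}$. An $N$-dimensional Boolean network is a pair $(2^{[N]},f)$ with $f:\{0,1\}^{[N]}\to\{0,1\}^{[N]}$; it is updated synchronously in discrete time by $\vec{s}(t+1)=f(\vec{s}(t))$, $t=0,1,2,\dots$. An attractor is a periodic orbit of $f$ (including fixed points); its length is the number of states in it. The network is cooperative if $\vec{s}\le\vec{s}^{\,*}$ coordinatewise implies $f(\vec{s})\le f(\vec{s}^{\,*})$ coordinatewise. The Hamming distance $H(\vec{s},\vec{s}^{\,*})$ is the number of coordinates in which $\vec{s}$ and $\vec{s}^{\,*}$ differ. A randomly chosen initial condition is uniformly distributed on $\{0,1\}^{[N]}$; a random one-bit flip changes the value of one coordinate chosen uniformly from $[N]$, independently of the state. The network is $p$-$c$-chaotic if with probability $>p$ the trajectory of a randomly chosen initial condition reaches an attractor of length $>c^N$. The network exhibits $p$-$\alpha$-decoherence if with probability $\ge p$ a random one-bit flip $\vec{s}^{\,*}(0)$ in a randomly chosen initial condition $\vec{s}(0)$ results in trajectories with $H(\vec{s}(t),\vec{s}^{\,*}(t))\ge \alpha N$ for infinitely many times $t>0$. *)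

theory Defs
  imports "HOL-Probability.Probability"
begin

text \<open>
  A state (an element of the N-dimensional Boolean cube) is an extensional function on \<open>{1..N}\<close>; the coordinate
  values 0 and 1 are \<^term>\<open>False\<close> and \<^term>\<open>True\<close>, with the library order on \<^typ>\<open>bool\<close>.
\<close>

type_synonym state = "nat \<Rightarrow> bool"

definition states :: "nat \<Rightarrow> state set" where
  "states N = {1..N} \<rightarrow>\<^sub>E (UNIV :: bool set)"

definition boolean_network :: "nat \<Rightarrow> (state \<Rightarrow> state) \<Rightarrow> bool" where
  "boolean_network N f \<longleftrightarrow> f \<in> states N \<rightarrow> states N"

definition state_le :: "nat \<Rightarrow> state \<Rightarrow> state \<Rightarrow> bool" where
  "state_le N s s' \<longleftrightarrow> (\<forall>i\<in>{1..N}. s i \<le> s' i)"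

definition cooperative :: "nat \<Rightarrow> (state \<Rightarrow> state) \<Rightarrow> bool" where
  "cooperative N f \<longleftrightarrow>
     (\<forall>s\<in>states N. \<forall>s'\<in>states N. state_le N s s' \<longrightarrow> state_le N (f s) (f s'))"

definition hamming :: "nat \<Rightarrow> state \<Rightarrow> state \<Rightarrow> nat" where
  "hamming N s s' = card {i\<in>{1..N}. s i \<noteq> s' i}"

definition trajectory :: "(state \<Rightarrow> state) \<Rightarrow> state \<Rightarrow> nat \<Rightarrow> state" where
  "trajectory f s t = (f ^^ t) s"

text \<open>The length of an attractor \<open>A\<close> is \<^term>\<open>card A\<close>.\<close>

definition attractor :: "nat \<Rightarrow> (state \<Rightarrow> state) \<Rightarrow> state set \<Rightarrow> bool" where
  "attractor N f A \<longleftrightarrow>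
     (\<exists>s\<in>states N. (\<exists>k>0. trajectory f s k = s) \<and> A = range (trajectory f s))"

definition reaches :: "(state \<Rightarrow> state) \<Rightarrow> state \<Rightarrow> state set \<Rightarrow> bool" where
  "reaches f s A \<longleftrightarrow> (\<exists>t. trajectory f s t \<in> A)"

definition flip :: "state \<Rightarrow> nat \<Rightarrow> state" where
  "flip s i = s(i := \<not> s i)"

definition random_state :: "nat \<Rightarrow> state pmf" where
  "random_state N = pmf_of_set (states N)"

text \<open>
  An initial state together with an independent coordinate to be flipped. For \<open>N = 0\<close> there is
  no coordinate and the distribution is unspecified, so it is meaningful for \<open>N \<ge> 1\<close> only.
\<close>

definition random_state_flip :: "nat \<Rightarrow> (state \<times> nat) pmf" where
  "random_state_flip N = pair_pmf (random_state N) (pmf_of_set {1..N})"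

definition chaotic :: "real \<Rightarrow> real \<Rightarrow> nat \<Rightarrow> (state \<Rightarrow> state) \<Rightarrow> bool" where
  "chaotic p c N f \<longleftrightarrow>
     measure_pmf.prob (random_state N)
       {s. \<exists>A. attractor N f A \<and> reaches f s A \<and> real (card A) > c ^ N} > p"

definition decoherent :: "real \<Rightarrow> real \<Rightarrow> nat \<Rightarrow> (state \<Rightarrow> state) \<Rightarrow> bool" where
  "decoherent p \<alpha> N f \<longleftrightarrow>
     measure_pmf.prob (random_state_flip N)
       {(s, i). infinite {t. t > 0 \<and>
          real (hamming N (trajectory f s t) (trajectory f (flip s i) t)) \<ge> \<alpha> * real N}} \<ge> p"

lemma finite_states: "finite (states N)"
  by (simp add: states_def finite_PiE)

lemma states_nonempty: "states N \<noteq> {}"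
  by (simp add: states_def PiE_eq_empty_iff)

lemma flip_in_states: "s \<in> states N \<Longrightarrow> i \<in> {1..N} \<Longrightarrow> flip s i \<in> states N"
  by (auto simp: states_def flip_def PiE_def extensional_def)

end

theory Submission
  imports Defs "HOL-Real_Asymp.Real_Asymp"
begin

text \<open>
  The only obstruction to prescribing the values of a monotone map on a set of states comes from
  comparable states: any order-preserving assignment extends to the whole cube, by letting a state
  take the supremum of the values prescribed below it (\<open>monotone_extension\<close>). Chaos is
  therefore cheap on an antichain, and a middle layer of the cube is an antichain of nearly
  \<open>2 ^ n\<close> states. The difficulty is decoherence: a state and its one-bit flip are
  comparable, hence so are their trajectories at all times, and both should stay on long cycles while
  becoming almost complementary again and again.

  The remedy is a bundle of \<open>m\<close> cycles \<open>orb 0, \<dots>, orb (m - 1)\<close> of a common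
  period \<open>P\<close> for which \<open>orb k t\<close> lies below \<open>orb k' t'\<close> exactly if
  \<open>t = t'\<close> and \<open>k \<le> k'\<close>. Three control blocks of \<open>m\<close> coordinates hold
  the level \<open>k\<close>, a phase, and the complement of the phase; the remaining
  \<open>N - 3 m\<close> coordinates are the data. In phase 0 the data run through the whole middle
  layer, which makes the period exceed \<open>c ^ N\<close>. In each phase \<open>j > 0\<close>, which
  lasts one step, all data coordinates are 0 on the cycles of level below \<open>j\<close> and 1 on the
  others. So two cycles of distinct levels differ in all data coordinates once per period, although
  they are ordered (\<open>ordered_orbits_exist\<close>).

  It remains to launch almost every initial state into the cycle whose level is its number of ones,
  shifted so that the typical values fall into \<open>{0..<m}\<close>. This is monotone, and flipping a bit
  changes the level. No conflict with the cycles arises, since a typical state has about as many ones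
  as zeros in each of the two phase blocks and is thus incomparable to the states on the cycles, which
  are one-hot on one block and one-cold on the other (\<open>chaotic_decoherent_network\<close>).
  With \<open>m\<close> proportional to \<open>N\<close>, Hoeffding's inequality makes all these events
  exponentially likely, while a small factor of proportionality leaves enough data coordinates for
  both \<open>\<alpha>\<close> and \<open>c\<close>.
\<close>

section \<open>Prescribing monotone dynamics on part of the cube\<close>

lemma state_le_refl: "state_le N s s"
  by (simp add: state_le_def)

lemma state_le_trans: "state_le N s u \<Longrightarrow> state_le N u v \<Longrightarrow> state_le N s v"
  unfolding state_le_def by (meson order_trans)

lemma state_le_antisym:
  assumes "s \<in> states N" "u \<in> states N" "state_le N s u" "state_le N u s"
  shows "s = u"
  using assms unfolding states_def state_le_def
  by (intro PiE_ext[of s "{1..N}" "\<lambda>_. UNIV" u]) (auto intro: antisym)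

text \<open>
  The extension is the least one: the supremum of the prescribed values below a state, read off
  coordinatewise. It is cooperative whatever \<open>g\<close> is; monotonicity of \<open>g\<close> is what makes
  it agree with \<open>g\<close> on \<open>D\<close>.
\<close>

lemma monotone_extension:
  assumes g: "\<And>s. s \<in> D \<Longrightarrow> g s \<in> states N"
    and mono: "\<And>s u. s \<in> D \<Longrightarrow> u \<in> D \<Longrightarrow> state_le N s u \<Longrightarrow> state_le N (g s) (g u)"
  obtains f where "boolean_network N f" "cooperative N f" "\<And>s. s \<in> D \<Longrightarrow> f s = g s"
proof
  define f where "f s = (\<lambda>i\<in>{1..N}. \<exists>u\<in>D. state_le N u s \<and> g u i)" for s
  have f_states: "f s \<in> states N" for s
    by (auto simp: f_def states_def)
  show "boolean_network N f"
    using f_states by (auto simp: boolean_network_def)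
  show "cooperative N f"
    unfolding cooperative_def
  proof (intro ballI impI)
    fix s u assume "state_le N s u"
    then show "state_le N (f s) (f u)"
      using state_le_trans[of N _ s u] unfolding state_le_def[of N "f s" "f u"]
      by (auto simp: f_def)
  qed
  show "f s = g s" if s: "s \<in> D" for s
  proof (rule state_le_antisym[OF f_states g[OF s]])
    show "state_le N (f s) (g s)"
      unfolding state_le_def[of N "f s" "g s"]
    proof (intro ballI le_boolI)
      fix i assume i: "i \<in> {1..N}" and "f s i"
      then obtain u where "u \<in> D" "state_le N u s" "g u i"
        by (auto simp: f_def)
      have "state_le N (g u) (g s)"
        by (rule mono) fact+
      with i \<open>g u i\<close> show "g s i"
        by (auto simp: state_le_def)
    qed
    show "state_le N (g s) (f s)"
      using state_le_refl[of N s] s unfolding state_le_def[of N "g s" "f s"]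
      by (auto simp: f_def)
  qed
qed

text \<open>
  The prescribed map moves along each orbit and sends \<open>s \<in> T\<close> to the starting point of the
  orbit of its level. It is order-preserving because comparable orbit states belong to the same time,
  and because no state of \<open>T\<close> is comparable to an orbit state.
\<close>

lemma ordered_orbits_realizable:
  fixes orb :: "nat \<Rightarrow> nat \<Rightarrow> state"
  assumes P: "0 < P"
    and orb: "\<And>k t. k < m \<Longrightarrow> t < P \<Longrightarrow> orb k t \<in> states N"
    and orb_le: "\<And>k t k' t'. k < m \<Longrightarrow> t < P \<Longrightarrow> k' < m \<Longrightarrow> t' < P \<Longrightarrow>
      state_le N (orb k t) (orb k' t') \<longleftrightarrow> t = t' \<and> k \<le> k'"
    and level: "\<And>s. s \<in> T \<Longrightarrow> level s < m"
    and level_mono: "\<And>s u. s \<in> T \<Longrightarrow> u \<in> T \<Longrightarrow> state_le N s u \<Longrightarrow> level s \<le> level u"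
    and T_orb: "\<And>s k t. s \<in> T \<Longrightarrow> k < m \<Longrightarrow> t < P \<Longrightarrow>
      \<not> state_le N s (orb k t) \<and> \<not> state_le N (orb k t) s"
  obtains f where "boolean_network N f" "cooperative N f"
    "\<And>s t. s \<in> T \<Longrightarrow> trajectory f s (Suc t) = orb (level s) (t mod P)"
proof -
  \<comment> \<open>The choice operator recovers the indices of an orbit state; they are unique by \<open>orb_inj\<close>.\<close>
  define D where "D = T \<union> {orb k t | k t. k < m \<and> t < P}"
  define g where "g s = (if s \<in> T then orb (level s) 0
    else SOME u. \<exists>k t. k < m \<and> t < P \<and> s = orb k t \<and> u = orb k (Suc t mod P))" for s
  have orb_inj: "k = k' \<and> t = t'"
    if "k < m" "t < P" "k' < m" "t' < P" "orb k t = orb k' t'" for k t k' t'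
  proof -
    have "state_le N (orb k t) (orb k' t')" "state_le N (orb k' t') (orb k t)"
      unfolding that(5) by (rule state_le_refl)+
    then show ?thesis
      using orb_le that(1-4) by (meson antisym)
  qed
  have g_T: "g s = orb (level s) 0" if "s \<in> T" for s
    using that by (simp add: g_def)
  have g_orb: "g (orb k t) = orb k (Suc t mod P)" if "k < m" "t < P" for k t
  proof -
    have "orb k t \<notin> T"
      using T_orb[of "orb k t" k t] that state_le_refl by blast
    moreover have "(SOME u. \<exists>k' t'. k' < m \<and> t' < P \<and> orb k t = orb k' t' \<and>
        u = orb k' (Suc t' mod P)) = orb k (Suc t mod P)"
      by (rule some_equality) (use that orb_inj in blast)+
    ultimately show ?thesis by (simp add: g_def)
  qed
  have mod_P: "Suc t mod P < P" for t
    using P by simp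
  have "g s \<in> states N" if "s \<in> D" for s
    using that level P by (auto simp: D_def g_T g_orb orb)
  moreover have "state_le N (g s) (g u)" if su: "s \<in> D" "u \<in> D" "state_le N s u" for s u
  proof -
    consider "s \<in> T" "u \<in> T"
      | k t k' t' where "s = orb k t" "u = orb k' t'" "k < m" "t < P" "k' < m" "t' < P"
      using su T_orb unfolding D_def by blast
    then show ?thesis
    proof cases
      case 1
      then show ?thesis
        using level_mono su(3) level P by (simp add: g_T orb_le)
    next
      case 2
      then have "t = t'" "k \<le> k'"
        using orb_le su(3) by blast+
      with 2 show ?thesis
        using mod_P by (simp add: g_orb orb_le)
    qed
  qed
  ultimately obtain f where f: "boolean_network N f" "cooperative N f" "\<And>s. s \<in> D \<Longrightarrow> f s = g s"
    using monotone_extension[of D g N] by blast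
  have "trajectory f s (Suc t) = orb (level s) (t mod P)" if s: "s \<in> T" for s t
  proof (induction t)
    case 0
    then show ?case
      using s by (simp add: trajectory_def f D_def g_T)
  next
    case (Suc t)
    have k: "level s < m" "t mod P < P"
      using level[OF s] P by auto
    have "trajectory f s (Suc (Suc t)) = f (orb (level s) (t mod P))"
      using Suc by (simp add: trajectory_def)
    also have "\<dots> = orb (level s) (Suc (t mod P) mod P)"
      using k by (subst f(3)) (auto simp: D_def g_orb)
    finally show ?case
      by (simp add: mod_Suc_eq)
  qed
  with f that show ?thesis by blast
qed

lemma cyclic_trajectory_attractor:
  assumes traj: "\<And>t. trajectory f s (Suc t) = z (t mod P)"
    and P: "0 < P" and z: "z 0 \<in> states N" "inj_on z {..<P}"
  shows "\<exists>A. attractor N f A \<and> reaches f s A \<and> card A = P"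
proof -
  have shift: "trajectory f (z 0) t = z (t mod P)" for t
  proof -
    have "trajectory f (trajectory f s (Suc 0)) t = trajectory f s (Suc t)"
      by (simp add: trajectory_def funpow_swap1)
    then show ?thesis
      using traj[of 0] traj[of t] P by simp
  qed
  have "range (trajectory f (z 0)) = z ` {..<P}"
  proof (intro equalityI image_subsetI)
    show "z t \<in> range (trajectory f (z 0))" if "t \<in> {..<P}" for t
      using shift[of t] that by (metis lessThan_iff mod_less rangeI)
  qed (use P in \<open>simp add: shift\<close>)
  moreover have "trajectory f (z 0) P = z 0"
    using shift[of P] by simp
  ultimately have "attractor N f (z ` {..<P})"
    using z P unfolding attractor_def by metis
  moreover have "reaches f s (z ` {..<P})"
    using traj[of 0] P unfolding reaches_def by (intro exI[of _ "Suc 0"]) auto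
  ultimately show ?thesis
    using z by (metis card_image card_lessThan)
qed

section \<open>Long parallel orbits\<close>

text \<open>
  The level \<open>k\<close> is in unary, so that the order of the numbers is the order of their codes. The
  phase \<open>j\<close> is one-hot in the second block, which makes distinct phases incomparable. The third
  block, its complement, prevents a typical state from lying above a coded one, as the second block
  prevents it from lying below.
\<close>

definition code_state :: "nat \<Rightarrow> nat \<Rightarrow> nat \<Rightarrow> nat \<Rightarrow> nat set \<Rightarrow> state" where
  "code_state N m k j X = (\<lambda>i\<in>{1..N}.
     if i \<le> m then i \<le> k
     else if i \<le> 2 * m then i = m + 1 + j
     else if i \<le> 3 * m then i \<noteq> 2 * m + 1 + j
     else i \<in> X)"

lemma code_state_in_states: "code_state N m k j X \<in> states N"
  by (auto simp: code_state_def states_def)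

lemma code_state_le_iff:
  assumes "3 * m \<le> N" "k < m" "k' < m" "j < m" "j' < m"
    and X: "X \<subseteq> {3 * m + 1..N}" "X' \<subseteq> {3 * m + 1..N}"
  shows "state_le N (code_state N m k j X) (code_state N m k' j' X')
    \<longleftrightarrow> k \<le> k' \<and> j = j' \<and> X \<subseteq> X'"
proof
  assume "state_le N (code_state N m k j X) (code_state N m k' j' X')"
  then have le: "code_state N m k j X i \<le> code_state N m k' j' X' i" if "i \<in> {1..N}" for i
    using that by (simp add: state_le_def)
  have "k \<le> k'"
    using le[of k] assms by (cases "k = 0") (auto simp: code_state_def)
  moreover have "j = j'"
    using le[of "m + 1 + j"] assms by (auto simp: code_state_def)
  moreover have "X \<subseteq> X'"
  proof
    fix i assume "i \<in> X"
    with X(1) have i: "3 * m + 1 \<le> i" "i \<le> N" by auto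
    then show "i \<in> X'"
      using le[of i] \<open>i \<in> X\<close> by (auto simp: code_state_def)
  qed
  ultimately show "k \<le> k' \<and> j = j' \<and> X \<subseteq> X'" by blast
next
  assume "k \<le> k' \<and> j = j' \<and> X \<subseteq> X'"
  then show "state_le N (code_state N m k j X) (code_state N m k' j' X')"
    by (auto simp: state_le_def code_state_def)
qed

abbreviation weight :: "nat set \<Rightarrow> state \<Rightarrow> nat" where
  "weight A s \<equiv> card {i \<in> A. s i}"

lemma weight_mono:
  assumes "state_le N s u" "A \<subseteq> {1..N}"
  shows "weight A s \<le> weight A u"
proof (rule card_mono)
  show "finite {i \<in> A. u i}"
    using assms(2) finite_subset by fastforce
  show "{i \<in> A. s i} \<subseteq> {i \<in> A. u i}"
    using assms by (auto simp: state_le_def)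
qed

lemma weight_clock_code_state:
  assumes "3 * m \<le> N" "j < m"
  shows "weight {m + 1..2 * m} (code_state N m k j X) = 1"
    and "weight {2 * m + 1..3 * m} (code_state N m k j X) = m - 1"
proof -
  have "{i \<in> {m + 1..2 * m}. code_state N m k j X i} = {m + 1 + j}"
    using assms by (auto simp: code_state_def)
  then show "weight {m + 1..2 * m} (code_state N m k j X) = 1"
    by simp
  have "{i \<in> {2 * m + 1..3 * m}. code_state N m k j X i} = {2 * m + 1..3 * m} - {2 * m + 1 + j}"
    using assms by (auto simp: code_state_def)
  then show "weight {2 * m + 1..3 * m} (code_state N m k j X) = m - 1"
    using assms by simp
qed

text \<open>
  The fixed weights of the phase blocks separate the orbits from typical states, and the last clause
  is the instant at which all orbits of level at least \<open>j\<close> have full data and all others have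
  empty data. The order on the orbits is respected even there, since the data grow with the level.
\<close>

lemma ordered_orbits_exist:
  fixes m N :: nat
  defines "V \<equiv> {3 * m + 1..N}"
  assumes m: "0 < m" and N: "3 * m \<le> N"
  obtains P and orb :: "nat \<Rightarrow> nat \<Rightarrow> state" where
    "(N - 3 * m) choose ((N - 3 * m) div 2) \<le> P"
    "\<And>k t. k < m \<Longrightarrow> t < P \<Longrightarrow> orb k t \<in> states N"
    "\<And>k t k' t'. k < m \<Longrightarrow> t < P \<Longrightarrow> k' < m \<Longrightarrow> t' < P \<Longrightarrow>
      state_le N (orb k t) (orb k' t') \<longleftrightarrow> t = t' \<and> k \<le> k'"
    "\<And>k t. k < m \<Longrightarrow> t < P \<Longrightarrow> weight {m + 1..2 * m} (orb k t) = 1"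
    "\<And>k t. k < m \<Longrightarrow> t < P \<Longrightarrow> weight {2 * m + 1..3 * m} (orb k t) = m - 1"
    "\<And>j. 0 < j \<Longrightarrow> j < m \<Longrightarrow> \<exists>t<P. \<forall>k<m. \<forall>i\<in>V. orb k t i \<longleftrightarrow> j \<le> k"
proof -
  define h where "h = (N - 3 * m) div 2"
  define M where "M = {X. X \<subseteq> V \<and> card X = h}"
  define L where "L = card M"
  have card_V: "card V = N - 3 * m"
    using N by (simp add: V_def)
  have L: "L = (N - 3 * m) choose h"
    unfolding L_def M_def using n_subsets[of V h] card_V by (simp add: V_def)
  have "finite M"
    unfolding M_def by (rule finite_subset[of _ "Pow V"]) (auto simp: V_def)
  then obtain X where X: "bij_betw X {0..<L} M"
    using ex_bij_betw_nat_finite L_def by blast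
  have X_V: "X t \<subseteq> V" and card_X: "card (X t) = h" if "t < L" for t
    using bij_betwE[OF X] that by (auto simp: M_def)
  \<comment> \<open>Time \<open>t < L\<close> has phase 0, as truncated subtraction gives \<open>t + 1 - L = 0\<close>; then
    the phases \<open>1, \<dots>, m - 1\<close> take one step each, whence the period \<open>L + m - 1\<close>.\<close>
  define data where "data k t = (if t < L then X t else if t + 1 - L \<le> k then V else {})" for k t
  define orb where "orb k t = code_state N m k (t + 1 - L) (data k t)" for k t
  define P where "P = L + m - 1"
  have data_V: "data k t \<subseteq> V" for k t
    using X_V by (auto simp: data_def)
  have phase: "t + 1 - L < m" if "t < P" for t
    using that m by (auto simp: P_def)
  have orb_le: "state_le N (orb k t) (orb k' t') \<longleftrightarrow> t = t' \<and> k \<le> k'"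
    if "k < m" "t < P" "k' < m" "t' < P" for k t k' t'
  proof -
    have eq: "state_le N (orb k t) (orb k' t') \<longleftrightarrow>
        k \<le> k' \<and> t + 1 - L = t' + 1 - L \<and> data k t \<subseteq> data k' t'"
      unfolding orb_def using code_state_le_iff[OF N] that phase data_V[unfolded V_def] by simp
    have "t = t'" if "t + 1 - L = t' + 1 - L" "data k t \<subseteq> data k' t'"
    proof (cases "t < L")
      case True
      then have "t' < L"
        using that(1) by auto
      with True that(2) have "X t \<subseteq> X t'"
        by (simp add: data_def)
      moreover have "finite (X t')"
        using X_V[OF \<open>t' < L\<close>] by (rule finite_subset) (simp add: V_def)
      ultimately have "X t = X t'"
        using card_X True \<open>t' < L\<close> by (intro card_subset_eq) auto
      with True \<open>t' < L\<close> show ?thesis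
        using bij_betw_imp_inj_on[OF X] by (auto dest: inj_onD)
    next
      case False
      with that(1) show ?thesis by auto
    qed
    moreover have "data k t \<subseteq> data k' t" if "k \<le> k'"
      using that by (auto simp: data_def)
    ultimately show ?thesis
      unfolding eq by blast
  qed
  have blow_up: "\<exists>t<P. \<forall>k<m. \<forall>i\<in>V. orb k t i \<longleftrightarrow> j \<le> k" if "0 < j" "j < m" for j
  proof (intro exI[of _ "L + j - 1"] conjI allI impI ballI)
    show "L + j - 1 < P"
      using that by (simp add: P_def)
    fix k i assume i: "i \<in> V"
    have "L + j - 1 + 1 - L = j" "\<not> L + j - 1 < L"
      using that by auto
    then show "orb k (L + j - 1) i \<longleftrightarrow> j \<le> k"
      using i by (auto simp: orb_def data_def code_state_def V_def)
  qed
  show thesis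
  proof (rule that[of P orb])
    show "(N - 3 * m) choose ((N - 3 * m) div 2) \<le> P"
      unfolding L[unfolded h_def, symmetric] using m by (simp add: P_def)
  qed (use orb_le blow_up weight_clock_code_state[OF N phase] code_state_in_states
       in \<open>auto simp: orb_def\<close>)
qed

section \<open>The network\<close>

text \<open>
  The first two conditions make the shifted weight an admissible level. The other two rule out
  comparability with a coded state, whose weights on the phase blocks are 1 and \<open>m - 1\<close>.
\<close>

definition launch_states :: "nat \<Rightarrow> nat \<Rightarrow> nat \<Rightarrow> state set" where
  "launch_states N m lo = {s \<in> states N. lo \<le> weight {1..N} s \<and> weight {1..N} s < lo + m \<and>
     2 \<le> weight {m + 1..2 * m} s \<and> weight {2 * m + 1..3 * m} s + 2 \<le> m}"

lemma chaotic_decoherent_network: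
  assumes m: "0 < m" and N: "3 * m \<le> N"
  obtains f where "boolean_network N f" "cooperative N f"
    "\<And>s. s \<in> launch_states N m lo \<Longrightarrow> \<exists>A. attractor N f A \<and> reaches f s A \<and>
       (N - 3 * m) choose ((N - 3 * m) div 2) \<le> card A"
    "\<And>s u. s \<in> launch_states N m lo \<Longrightarrow> u \<in> launch_states N m lo \<Longrightarrow>
       weight {1..N} s \<noteq> weight {1..N} u \<Longrightarrow>
       infinite {t. 0 < t \<and> N - 3 * m \<le> hamming N (trajectory f s t) (trajectory f u t)}"
proof -
  obtain P and orb :: "nat \<Rightarrow> nat \<Rightarrow> state" where
    P: "(N - 3 * m) choose ((N - 3 * m) div 2) \<le> P" and
    orb: "\<And>k t. k < m \<Longrightarrow> t < P \<Longrightarrow> orb k t \<in> states N" and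
    orb_le: "\<And>k t k' t'. k < m \<Longrightarrow> t < P \<Longrightarrow> k' < m \<Longrightarrow> t' < P \<Longrightarrow>
      state_le N (orb k t) (orb k' t') \<longleftrightarrow> t = t' \<and> k \<le> k'" and
    clock: "\<And>k t. k < m \<Longrightarrow> t < P \<Longrightarrow> weight {m + 1..2 * m} (orb k t) = 1" and
    coclock: "\<And>k t. k < m \<Longrightarrow> t < P \<Longrightarrow> weight {2 * m + 1..3 * m} (orb k t) = m - 1" and
    blow_up: "\<And>j. 0 < j \<Longrightarrow> j < m \<Longrightarrow> \<exists>t<P. \<forall>k<m. \<forall>i\<in>{3 * m + 1..N}. orb k t i \<longleftrightarrow> j \<le> k"
    by (rule ordered_orbits_exist[OF m N], rule that, assumption+)
  have P_pos: "0 < P"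
    by (rule less_le_trans[OF _ P]) simp
  define level where "level s = weight {1..N} s - lo" for s
  define T where "T = launch_states N m lo"
  have level: "level s < m" if "s \<in> T" for s
    using that m by (auto simp: T_def launch_states_def level_def)
  have level_mono: "level s \<le> level u" if "state_le N s u" for s u
    unfolding level_def using weight_mono[OF that, of "{1..N}"] by (simp add: diff_le_mono)
  have incomparable: "\<not> state_le N s (orb k t) \<and> \<not> state_le N (orb k t) s"
    if "s \<in> T" "k < m" "t < P" for s k t
  proof
    show "\<not> state_le N s (orb k t)"
      using weight_mono[of N s "orb k t" "{m + 1..2 * m}"] clock[OF that(2,3)] that(1) N
      by (auto simp: T_def launch_states_def)
    show "\<not> state_le N (orb k t) s"
      using weight_mono[of N "orb k t" s "{2 * m + 1..3 * m}"] coclock[OF that(2,3)] that(1) N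
      by (auto simp: T_def launch_states_def)
  qed
  obtain f where f: "boolean_network N f" "cooperative N f" and
    traj: "\<And>s t. s \<in> T \<Longrightarrow> trajectory f s (Suc t) = orb (level s) (t mod P)"
    by (rule ordered_orbits_realizable[of P m orb N T level, OF P_pos orb orb_le level level_mono
        incomparable], assumption+, rule that, assumption+)
  have long: "\<exists>A. attractor N f A \<and> reaches f s A \<and>
      (N - 3 * m) choose ((N - 3 * m) div 2) \<le> card A" if "s \<in> T" for s
  proof -
    have "inj_on (orb (level s)) {..<P}"
    proof (rule inj_onI)
      fix t t' assume t: "t \<in> {..<P}" "t' \<in> {..<P}" and eq: "orb (level s) t = orb (level s) t'"
      have "state_le N (orb (level s) t) (orb (level s) t')"
        unfolding eq by (rule state_le_refl)
      with t show "t = t'"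
        using orb_le level[OF that] by blast
    qed
    then show ?thesis
      using cyclic_trajectory_attractor[of f s "orb (level s)" P N] traj[OF that] P_pos
        orb[OF level[OF that]] P by auto
  qed
  have separated: "infinite {t. 0 < t \<and> N - 3 * m \<le> hamming N (trajectory f s t) (trajectory f u t)}"
    if "s \<in> T" "u \<in> T" "weight {1..N} s \<noteq> weight {1..N} u" for s u
  proof -
    have neq: "level s \<noteq> level u"
      using that by (auto simp: T_def launch_states_def level_def)
    \<comment> \<open>In phase \<open>j\<close> the higher of the two levels is already full and the lower one still empty.\<close>
    define j where "j = max (level s) (level u)"
    have "0 < j" "j < m"
      using neq level[OF that(1)] level[OF that(2)] by (auto simp: j_def)
    then obtain t where t: "t < P" "\<forall>k<m. \<forall>i\<in>{3 * m + 1..N}. orb k t i \<longleftrightarrow> j \<le> k"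
      using blow_up[of j] by auto
    have "N - 3 * m \<le> hamming N (trajectory f s (Suc (t + P * r))) (trajectory f u (Suc (t + P * r)))"
      for r
    proof -
      have "trajectory f s (Suc (t + P * r)) i \<noteq> trajectory f u (Suc (t + P * r)) i"
        if i: "i \<in> {3 * m + 1..N}" for i
      proof -
        have "trajectory f v (Suc (t + P * r)) i \<longleftrightarrow> j \<le> level v" if "v \<in> T" for v
          unfolding traj[OF that] using t i level[OF that] by simp
        then show ?thesis
          using \<open>s \<in> T\<close> \<open>u \<in> T\<close> neq by (auto simp: j_def max_def)
      qed
      then have "card {3 * m + 1..N} \<le> hamming N (trajectory f s (Suc (t + P * r)))
          (trajectory f u (Suc (t + P * r)))"
        unfolding hamming_def by (intro card_mono) auto
      then show ?thesis by simp
    qed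
    then have "range (\<lambda>r. Suc (t + P * r)) \<subseteq>
        {t. 0 < t \<and> N - 3 * m \<le> hamming N (trajectory f s t) (trajectory f u t)}"
      by auto
    moreover have "infinite (range (\<lambda>r. Suc (t + P * r)))"
      using P_pos by (intro range_inj_infinite injI) simp
    ultimately show ?thesis
      using infinite_super by blast
  qed
  show thesis
    by (rule that[OF f long[unfolded T_def] separated[unfolded T_def]])
qed

section \<open>Typical initial states\<close>

lemma map_weight_random_state:
  assumes A: "A \<subseteq> {1..N}"
  shows "map_pmf (weight A) (random_state N) = binomial_pmf (card A) (1 / 2)"
proof -
  let ?B = "\<lambda>_::nat. bernoulli_pmf (1 / 2)"
  have states: "states N = PiE_dflt {1..N} undefined (\<lambda>_. UNIV)"
    by (auto simp: states_def PiE_dflt_def PiE_def extensional_def)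
  have random: "random_state N = Pi_pmf {1..N} undefined ?B"
    unfolding random_state_def states bernoulli_pmf_half_conv_pmf_of_set
    by (subst Pi_pmf_of_set) auto
  have "binomial_pmf (card A) (1 / 2) = map_pmf (weight A) (Pi_pmf A undefined ?B)"
    using A finite_subset[OF A] by (intro binomial_pmf_altdef') auto
  also have "\<dots> = map_pmf (weight A) (random_state N)"
    unfolding random Pi_pmf_subset[OF finite_atLeastAtMost A] map_pmf_comp
    by (intro map_pmf_cong refl arg_cong[of _ _ card]) auto
  finally show ?thesis ..
qed

lemma weight_concentration:
  assumes "A \<subseteq> {1..N}" "card A = n" "0 < n" "0 \<le> d"
  shows "measure_pmf.prob (random_state N) {s. d \<le> \<bar>real (weight A s) - real n / 2\<bar>}
    \<le> 2 * exp (- 2 * d\<^sup>2 / real n)"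
proof -
  have "measure_pmf.prob (random_state N) {s. d \<le> \<bar>real (weight A s) - real n / 2\<bar>}
      = measure_pmf.prob (map_pmf (weight A) (random_state N)) {x. d \<le> \<bar>real x - real n * (1 / 2)\<bar>}"
    by simp
  also have "\<dots> \<le> 2 * exp (- 2 * d\<^sup>2 / real n)"
    unfolding map_weight_random_state[OF assms(1)] assms(2)
    using binomial_distribution.prob_abs_ge[of "1 / 2" n d] assms
    by (simp add: binomial_distribution_def)
  finally show ?thesis .
qed

text \<open>
  For large \<open>m\<close> the margins are stricter than those of \<^const>\<open>launch_states\<close>, so that a typical state remains
  launchable after one flip; this holds for every choice of the coordinate.
\<close>

definition typical_states :: "nat \<Rightarrow> nat \<Rightarrow> state set" where
  "typical_states N m = {s \<in> states N.
     \<bar>real (weight {1..N} s) - real N / 2\<bar> < real m / 4 \<and>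
     \<bar>real (weight {m + 1..2 * m} s) - real m / 2\<bar> < real m / 4 \<and>
     \<bar>real (weight {2 * m + 1..3 * m} s) - real m / 2\<bar> < real m / 4}"

text \<open>
  A union bound over three applications of Hoeffding's inequality. On the phase blocks the exponent
  is even \<open>m / 8\<close>; it is weakened to that of the total weight.
\<close>

lemma prob_typical_states:
  assumes m: "0 < m" and N: "3 * m \<le> N"
  shows "1 - 6 * exp (- (real m)\<^sup>2 / (8 * real N)) \<le>
    measure_pmf.prob (random_state N) (typical_states N m)"
proof -
  let ?pr = "measure_pmf.prob (random_state N)"
  let ?\<delta> = "exp (- (real m)\<^sup>2 / (8 * real N))"
  define bad where "bad A n = {s. real m / 4 \<le> \<bar>real (weight A s) - real n / 2\<bar>}" for A and n :: nat
  have tail: "?pr (bad A n) \<le> 2 * ?\<delta>"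
    if "A \<subseteq> {1..N}" "card A = n" "0 < n" "n \<le> N" for A n
  proof -
    have "?pr (bad A n) \<le> 2 * exp (- 2 * (real m / 4)\<^sup>2 / real n)"
      unfolding bad_def using that by (intro weight_concentration) auto
    moreover have "(real m)\<^sup>2 / (8 * real N) \<le> (real m)\<^sup>2 / (8 * real n)"
      using that m by (intro divide_left_mono) auto
    then have "- 2 * (real m / 4)\<^sup>2 / real n \<le> - (real m)\<^sup>2 / (8 * real N)"
      by (simp add: power_divide)
    ultimately show ?thesis
      by (smt (verit) exp_le_cancel_iff)
  qed
  let ?U = "bad {1..N} N \<union> bad {m + 1..2 * m} m \<union> bad {2 * m + 1..3 * m} m"
  have "?pr ?U \<le> ?pr (bad {1..N} N) + ?pr (bad {m + 1..2 * m} m) + ?pr (bad {2 * m + 1..3 * m} m)"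
    by (intro order_trans[OF measure_Un_le] add_mono) auto
  also have "\<dots> \<le> 6 * ?\<delta>"
    using tail[of "{1..N}" N] tail[of "{m + 1..2 * m}" m] tail[of "{2 * m + 1..3 * m}" m] m N
    by simp
  finally have U: "?pr ?U \<le> 6 * ?\<delta>" .
  have "set_pmf (random_state N) = states N"
    unfolding random_state_def by (intro set_pmf_of_set states_nonempty finite_states)
  then have "?pr (typical_states N m) = ?pr (- ?U)"
    by (intro measure_prob_cong_0)
       (auto simp: typical_states_def bad_def set_pmf_eq not_le not_less)
  also have "\<dots> = 1 - ?pr ?U"
    using measure_pmf.prob_compl[of ?U "random_state N"] by (simp add: Compl_eq_Diff_UNIV)
  finally show ?thesis
    using U by simp
qed

lemma weight_flip:
  assumes "finite A"
  shows "weight A (flip s i) =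
    (if i \<in> A then if s i then weight A s - 1 else weight A s + 1 else weight A s)"
proof -
  have "{x \<in> A. flip s i x} =
      (if i \<in> A then if s i then {x \<in> A. s x} - {i} else insert i {x \<in> A. s x} else {x \<in> A. s x})"
    by (auto simp: flip_def)
  then show ?thesis
    using assms by auto
qed

lemma weight_pos: "finite A \<Longrightarrow> i \<in> A \<Longrightarrow> s i \<Longrightarrow> 0 < weight A s"
  by (auto simp: card_gt_0_iff)

lemma weight_flip_bounds:
  assumes "finite A"
  shows "weight A (flip s i) \<le> weight A s + 1" "weight A s \<le> weight A (flip s i) + 1"
  using weight_flip[OF assms, of s i] by auto

text \<open>
  The offset \<open>(N - m) div 2\<close> centres the window of \<open>m\<close> admissible weights at \<open>N / 2\<close>.
  For \<open>m \<ge> 12\<close> each phase block of a typical state has more than \<open>m / 4 \<ge> 3\<close> ones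
  and more than that many zeros, which covers the threshold 2 of a launch state and the one unit that a flip
  can cost.
\<close>

lemma typical_launch:
  assumes m: "12 \<le> m" "m \<le> N" and s: "s \<in> typical_states N m" and i: "i \<in> {1..N}"
  shows "s \<in> launch_states N m ((N - m) div 2)"
    and "flip s i \<in> launch_states N m ((N - m) div 2)"
    and "weight {1..N} s \<noteq> weight {1..N} (flip s i)"
proof -
  define lo where "lo = (N - m) div 2"
  have "s \<in> states N"
    using s by (simp add: typical_states_def)
  have w: "weight {m + 1..2 * m} s \<ge> 3" "weight {2 * m + 1..3 * m} s + 3 \<le> m"
    "4 * weight {1..N} s < 2 * N + m" "2 * N < 4 * weight {1..N} s + m"
    using s m unfolding typical_states_def mem_Collect_eq by linarith+
  have div: "2 * lo \<le> N - m" "N - m \<le> 2 * lo + 1"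
    unfolding lo_def by linarith+
  have lo: "lo + 1 \<le> weight {1..N} s" "weight {1..N} s + 1 < lo + m"
    using w(3,4) m div by linarith+
  show "s \<in> launch_states N m ((N - m) div 2)"
    using \<open>s \<in> states N\<close> w lo unfolding launch_states_def lo_def[symmetric] by auto
  show "flip s i \<in> launch_states N m ((N - m) div 2)"
    using flip_in_states[OF \<open>s \<in> states N\<close> i] w lo
      weight_flip_bounds[of "{1..N}" s i] weight_flip_bounds[of "{m + 1..2 * m}" s i]
      weight_flip_bounds[of "{2 * m + 1..3 * m}" s i]
    unfolding launch_states_def lo_def[symmetric] by simp
  show "weight {1..N} s \<noteq> weight {1..N} (flip s i)"
    using weight_flip[of "{1..N}" s i] weight_pos[of "{1..N}" i s] i by auto
qed

section \<open>Choosing the block length\<close>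

text \<open>The largest of the \<open>n + 1\<close> entries of a row of Pascal's triangle is at least their mean.\<close>

lemma central_binomial_ge: "2 ^ n \<le> (n + 1) * (n choose (n div 2))"
proof -
  have "2 ^ n = (\<Sum>k\<le>n. n choose k)"
    by (rule choose_row_sum[symmetric])
  also have "\<dots> \<le> (\<Sum>k\<le>n. n choose (n div 2))"
    by (intro sum_mono binomial_maximum)
  finally show ?thesis by simp
qed

lemma chaotic_decoherent_network_of_bounds:
  assumes m: "12 \<le> m" and N: "3 * m < N"
    and \<alpha>: "\<alpha> * real N \<le> real N - 3 * real m"
    and c: "(real N + 1) * c ^ N < 2 ^ (N - 3 * m)" "0 < c"
    and p: "p < 1 - 6 * exp (- (real m)\<^sup>2 / (8 * real N))"
  shows "\<exists>f. boolean_network N f \<and> cooperative N f \<and> chaotic p c N f \<and> decoherent p \<alpha> N f"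
proof -
  have m0: "0 < m" and m_le: "m \<le> N" and N': "3 * m \<le> N"
    using m N by auto
  define C where "C = (N - 3 * m) choose ((N - 3 * m) div 2)"
  obtain f where f: "boolean_network N f" "cooperative N f" and
    long: "\<And>s. s \<in> launch_states N m ((N - m) div 2) \<Longrightarrow>
      \<exists>A. attractor N f A \<and> reaches f s A \<and> C \<le> card A" and
    separated: "\<And>s u. s \<in> launch_states N m ((N - m) div 2) \<Longrightarrow>
       u \<in> launch_states N m ((N - m) div 2) \<Longrightarrow> weight {1..N} s \<noteq> weight {1..N} u \<Longrightarrow>
       infinite {t. 0 < t \<and> N - 3 * m \<le> hamming N (trajectory f s t) (trajectory f u t)}"
    using chaotic_decoherent_network[OF m0 N'] unfolding C_def by blast
  let ?E = "typical_states N m"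
  have E: "p < measure_pmf.prob (random_state N) ?E"
    using prob_typical_states[OF m0 N'] p by linarith
  have one: "1 \<in> {1..N}"
    using N by auto
  have "c ^ N < real C"
  proof -
    have "(real N + 1) * c ^ N < real ((N - 3 * m + 1) * C)"
    proof (rule less_le_trans[OF c(1)])
      have "real (2 ^ (N - 3 * m)) \<le> real ((N - 3 * m + 1) * C)"
        unfolding C_def by (rule of_nat_mono[OF central_binomial_ge])
      then show "2 ^ (N - 3 * m) \<le> real ((N - 3 * m + 1) * C)"
        by simp
    qed
    also have "\<dots> \<le> (real N + 1) * real C"
      unfolding of_nat_mult by (intro mult_right_mono) auto
    finally show ?thesis by simp
  qed
  then have "?E \<subseteq> {s. \<exists>A. attractor N f A \<and> reaches f s A \<and> c ^ N < real (card A)}"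
    using long[OF typical_launch(1)[OF m m_le _ one]] by (fastforce intro: less_le_trans)
  then have "measure_pmf.prob (random_state N) ?E \<le> measure_pmf.prob (random_state N)
      {s. \<exists>A. attractor N f A \<and> reaches f s A \<and> c ^ N < real (card A)}"
    by (intro measure_pmf.finite_measure_mono) auto
  with E have chaos: "chaotic p c N f"
    unfolding chaotic_def by linarith
  let ?F = "{(s, i). infinite {t. t > 0 \<and>
    real (hamming N (trajectory f s t) (trajectory f (flip s i) t)) \<ge> \<alpha> * real N}}"
  have "(s, i) \<in> ?F" if "s \<in> ?E" "i \<in> {1..N}" for s i
  proof -
    have "\<alpha> * real N \<le> real h" if "N - 3 * m \<le> h" for h
      using that \<alpha> N by linarith
    then have "{t. 0 < t \<and> N - 3 * m \<le> hamming N (trajectory f s t) (trajectory f (flip s i) t)}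
      \<subseteq> {t. t > 0 \<and> real (hamming N (trajectory f s t) (trajectory f (flip s i) t)) \<ge> \<alpha> * real N}"
      by auto
    then show ?thesis
      using separated[OF typical_launch[OF m m_le that]] infinite_super by auto
  qed
  then have sub: "?E \<times> {1..N} \<subseteq> ?F"
    by blast
  have countable_E: "countable ?E"
    by (rule countable_subset[OF _ countable_finite[OF finite_states[of N]]])
       (auto simp: typical_states_def)
  have "measure_pmf.prob (random_state N) ?E
      = measure_pmf.prob (random_state_flip N) (?E \<times> {1..N})"
    unfolding random_state_flip_def using countable_E one
    by (subst measure_pmf_prob_product) (auto simp: measure_pmf_of_set)
  also have "\<dots> \<le> measure_pmf.prob (random_state_flip N) ?F"
    using sub by (intro measure_pmf.finite_measure_mono) auto
  finally have "decoherent p \<alpha> N f"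
    unfolding decoherent_def using E by linarith
  with f chaos show ?thesis by blast
qed

theorem theorem3p7:
  fixes \<alpha> p c :: real
  assumes "0 < \<alpha>" and "\<alpha> < 1"
    and "0 < p" and "p < 1"
    and "1 < c" and "c < 2"
  shows "\<forall>\<^sub>F N in sequentially. \<exists>f. boolean_network N f \<and> cooperative N f \<and>
           chaotic p c N f \<and> decoherent p \<alpha> N f"
proof -
  \<comment> \<open>The data fill a fraction \<open>1 - 3 * \<epsilon>\<close> of the coordinates. It must exceed \<open>\<alpha>\<close> for the
    distance and \<open>log 2 c\<close> for the period; halfway between their maximum and 1 is a safe choice.\<close>
  define \<beta> where "\<beta> = max \<alpha> (log 2 c)"
  have "log 2 c < 1"
    using assms by (simp add: log_less_one_cancel_iff)
  then have \<beta>: "0 < \<beta>" "\<beta> < 1"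
    using assms by (auto simp: \<beta>_def)
  define \<epsilon> where "\<epsilon> = (1 - \<beta>) / 6"
  have \<epsilon>: "0 < \<epsilon>" "\<epsilon> < 1 / 6" "\<alpha> < 1 - 3 * \<epsilon>" "log 2 c < 1 - 3 * \<epsilon>"
    using \<beta> by (auto simp: \<epsilon>_def \<beta>_def field_simps)
  define m where "m N = nat \<lfloor>\<epsilon> * real N\<rfloor>" for N
  have m_le: "real (m N) \<le> \<epsilon> * real N" for N
    using \<epsilon> by (simp add: m_def)
  have m_ge: "\<epsilon> * real N - 1 \<le> real (m N)" for N
    using \<epsilon> unfolding m_def by linarith
  \<comment> \<open>The surplus in the exponent absorbs the factor \<open>N + 1\<close> lost in the central binomial coefficient.\<close>
  define \<delta> where "\<delta> = (1 - 3 * \<epsilon>) * ln 2 - ln c"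
  have \<delta>: "0 < \<delta>"
    using \<epsilon>(4) by (simp add: \<delta>_def log_def field_simps)
  have "\<forall>\<^sub>F N in sequentially. real N + 1 < exp (\<delta> * real N)"
    using \<delta> by real_asymp
  moreover have "\<forall>\<^sub>F N in sequentially. 13 \<le> \<epsilon> * real N"
    using \<epsilon>(1) by real_asymp
  moreover have "\<forall>\<^sub>F N in sequentially. 6 * exp (- (\<epsilon>\<^sup>2 / 32 * real N)) < 1 - p"
  proof -
    have "0 < \<epsilon>\<^sup>2 / 32"
      using \<epsilon>(1) by simp
    then have "(\<lambda>N. 6 * exp (- (\<epsilon>\<^sup>2 / 32 * real N))) \<longlonglongrightarrow> 0"
      by real_asymp
    then show ?thesis
      by (rule order_tendstoD(2)) (use assms in simp)
  qed
  ultimately show ?thesis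
  proof eventually_elim
    case (elim N)
    have N: "0 < real N"
      using elim(2) \<epsilon>(1) by (cases N) auto
    show ?case
    proof (rule chaotic_decoherent_network_of_bounds[of "m N"])
      show "12 \<le> m N"
        using m_ge[of N] elim(2) by linarith
      have "3 * real (m N) < real N"
        using m_le[of N] mult_strict_right_mono[OF \<epsilon>(2) N] N by linarith
      then show m_N: "3 * m N < N"
        by linarith
      show "\<alpha> * real N \<le> real N - 3 * real (m N)"
        using m_le[of N] mult_strict_right_mono[OF \<epsilon>(3) N] by (simp add: algebra_simps)
      show "0 < c"
        using assms by simp
      have c_pow: "c ^ N = exp (ln c * real N)"
        using assms by (simp add: exp_of_nat2_mult)
      have "(real N + 1) * c ^ N < exp (\<delta> * real N) * c ^ N"
        using elim(1) assms by (intro mult_strict_right_mono) auto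
      also have "\<dots> = 2 powr ((1 - 3 * \<epsilon>) * real N)"
        unfolding c_pow by (simp add: \<delta>_def powr_def exp_add[symmetric] algebra_simps)
      also have "\<dots> \<le> 2 powr real (N - 3 * m N)"
        using m_le[of N] m_N by (intro powr_mono) (auto simp: algebra_simps of_nat_diff)
      also have "\<dots> = 2 ^ (N - 3 * m N)"
        by (rule powr_realpow) simp
      finally show "(real N + 1) * c ^ N < 2 ^ (N - 3 * m N)" .
      have "\<epsilon> * real N / 2 \<le> real (m N)"
        using m_ge[of N] elim(2) by linarith
      then have "(\<epsilon> * real N / 2)\<^sup>2 \<le> (real (m N))\<^sup>2"
        using \<epsilon>(1) by (intro power_mono) auto
      then have "(\<epsilon> * real N / 2)\<^sup>2 / (8 * real N) \<le> (real (m N))\<^sup>2 / (8 * real N)"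
        by (intro divide_right_mono) auto
      also have "(\<epsilon> * real N / 2)\<^sup>2 / (8 * real N) = \<epsilon>\<^sup>2 / 32 * real N"
        using N by (simp add: power2_eq_square field_simps)
      finally have "exp (- (real (m N))\<^sup>2 / (8 * real N)) \<le> exp (- (\<epsilon>\<^sup>2 / 32 * real N))"
        by simp
      then show "p < 1 - 6 * exp (- (real (m N))\<^sup>2 / (8 * real N))"
        using elim(3) by linarith
    qed
  qed
qed

end
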